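(* Let $S$ be a monoid. Products of indecomposable right $S$-acts are indecomposable (i.e. for every family $(A_i)_{i\in I}$ of indecomposable right $S$-acts, the right $S$-act $\prod_{i\in I}A_i$ is indecomposable) if and only if $S$ has a right zero.
   Context: A right $S$-act over a monoid $S$ is a nonempty set $A$ with a map $A\times S\to A$, $(a,s)\mapsto as$, such that $a(st)=(as)t$ and $a1=a$ for all $a\in A$, $s,t\in S$. A subact is a nonempty subset closed under the action. A right $S$-act $A$ is decomposable if there are subacts $B,C\subseteq A$ (both nonempty) with $A=B\cup C$ and $B\cap C=\emptyset$; otherwise it is indecomposable. Products of right $S$-acts are Cartesian products with componentwise action. A right zero of $S$ is an element $z\in S$ with $sz=z$ for all $s\in S$. *)

theory Defs
  imports "HOL-Algebra.Group" "HOL-Library.FuncSet"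
begin

locale right_act = monoid S for S (structure) +
  fixes A :: "'b set" and act :: "'b \<Rightarrow> 'a \<Rightarrow> 'b"
  assumes nonempty: "A \<noteq> {}"
    and act_closed: "\<lbrakk>a \<in> A; s \<in> carrier S\<rbrakk> \<Longrightarrow> act a s \<in> A"
    and act_mult: "\<lbrakk>a \<in> A; s \<in> carrier S; t \<in> carrier S\<rbrakk>
      \<Longrightarrow> act a (s \<otimes> t) = act (act a s) t"
    and act_one: "a \<in> A \<Longrightarrow> act a \<one> = a"

definition subact ::
  "('s, 'm) monoid_scheme \<Rightarrow> 'a set \<Rightarrow> ('a \<Rightarrow> 's \<Rightarrow> 'a) \<Rightarrow> 'a set \<Rightarrow> bool"
  where "subact S A act B \<longleftrightarrow>
    B \<subseteq> A \<and> B \<noteq> {} \<and> (\<forall>b\<in>B. \<forall>s\<in>carrier S. act b s \<in> B)"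

definition decomposable ::
  "('s, 'm) monoid_scheme \<Rightarrow> 'a set \<Rightarrow> ('a \<Rightarrow> 's \<Rightarrow> 'a) \<Rightarrow> bool"
  where "decomposable S A act \<longleftrightarrow>
    (\<exists>B C. subact S A act B \<and> subact S A act C \<and> A = B \<union> C \<and> B \<inter> C = {})"

definition indecomposable_act ::
  "('s, 'm) monoid_scheme \<Rightarrow> 'a set \<Rightarrow> ('a \<Rightarrow> 's \<Rightarrow> 'a) \<Rightarrow> bool"
  where "indecomposable_act S A act \<longleftrightarrow> right_act S A act \<and> \<not> decomposable S A act"

text \<open>The product of a family of acts has carrier \<open>PiE I A\<close>, the extensional choice functions
  on \<open>I\<close>; the restriction in the action keeps the result extensional.\<close>

definition prod_act ::
  "'i set \<Rightarrow> ('i \<Rightarrow> 'a \<Rightarrow> 's \<Rightarrow> 'a) \<Rightarrow> ('i \<Rightarrow> 'a) \<Rightarrow> 's \<Rightarrow> ('i \<Rightarrow> 'a)"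
  where "prod_act I act f s = (\<lambda>i\<in>I. act i (f i) s)"

text \<open>HOL cannot quantify over types inside a formula, so the types in which the index sets and
  the carriers of the families live are parameters.\<close>

definition products_indecomposable ::
  "('s, 'm) monoid_scheme \<Rightarrow> 'i itself \<Rightarrow> 'a itself \<Rightarrow> bool"
  where "products_indecomposable S TYPE('i) TYPE('a) \<longleftrightarrow>
    (\<forall>(I :: 'i set) (A :: 'i \<Rightarrow> 'a set) (act :: 'i \<Rightarrow> 'a \<Rightarrow> 's \<Rightarrow> 'a).
      (\<forall>i\<in>I. indecomposable_act S (A i) (act i)) \<longrightarrow>
      indecomposable_act S (PiE I A) (prod_act I act))"

definition right_zero :: "('s, 'm) monoid_scheme \<Rightarrow> 's \<Rightarrow> bool"
  where "right_zero S z \<longleftrightarrow>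
    z \<in> carrier S \<and> (\<forall>s\<in>carrier S. s \<otimes>\<^bsub>S\<^esub> z = z)"

text \<open>The two types below are large enough to lose no families. Two points of an act lie in
  the same component iff they are joined by a finite zigzag
  \<open>a s\<^sub>1 = a\<^sub>1 t\<^sub>1\<close>, \<open>a\<^sub>1 s\<^sub>2 = a\<^sub>2 t\<^sub>2\<close>, ..., \<open>a\<^sub>n\<^sub>-\<^sub>1 s\<^sub>n = b t\<^sub>n\<close>, whose scheme
  \<open>(s\<^sub>1, t\<^sub>1), ..., (s\<^sub>n, t\<^sub>n)\<close> must be common to all coordinates in a product. If \<open>a\<close> and \<open>b\<close> lie
  in different components of some product of indecomposable acts, pick for each scheme a
  coordinate in which it fails to join \<open>a\<close> to \<open>b\<close>, and in it a finitely generated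
  indecomposable subact containing the two coordinates. These subacts form a family indexed by
  schemes with decomposable product, and each of them is a quotient of finitely many copies of
  \<open>S\<close>.\<close>

type_synonym 's scheme_index = "('s \<times> 's) list"
type_synonym 's act_carrier = "(nat \<times> 's) set"

end

theory Submission imports Defs begin

text \<open>A right zero \<open>z\<close> satisfies \<open>(a s) z = a z\<close>, so \<open>a \<mapsto> a z\<close> is constant on every
  indecomposable act, hence on every product of indecomposable acts; two complementary subacts
  would both contain its value.

  For the converse, suppose first that any two principal right ideals of \<open>S\<close> meet. Then the
  elements \<open>f\<close> of \<open>S\<^sup>S\<close> for which some \<open>f q\<close> is constant form a subact with
  complement closed under the action. If the complement is empty, the identity function lies in
  this subact, and \<open>s q\<close> being independent of \<open>s\<close> says that \<open>q\<close> is a right zero. If instead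
  \<open>u S\<close> and \<open>v S\<close> are disjoint, glue copies of \<open>S\<close> indexed by the natural numbers, consecutive
  ones alternately along \<open>u S\<close> and \<open>v S\<close>. This act is indecomposable, but an action step
  lowers the index by at most one and never raises it, so in a countable power the sequences of
  bounded index split off.\<close>

section \<open>Right zeros and indecomposable products\<close>

text \<open>The equivalence in \<open>P_act\<close> makes both \<open>P\<close> and its negation
  closed under the action, so each of them cuts out a subact. All decompositions built from a
  predicate below use this.\<close>

lemma (in right_act) decomposableI:
  assumes P_act: "\<And>x s. x \<in> A \<Longrightarrow> s \<in> carrier S \<Longrightarrow> P (act x s) \<longleftrightarrow> P x"
    and "a \<in> A" "P a" "b \<in> A" "\<not> P b"
  shows "decomposable S A act"
proof -
  let ?B = "{x \<in> A. P x}" and ?C = "{x \<in> A. \<not> P x}"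
  have "subact S A act ?B" "subact S A act ?C"
    using assms act_closed by (auto simp: subact_def)
  moreover have "A = ?B \<union> ?C" "?B \<inter> ?C = {}"
    by auto
  ultimately show ?thesis
    unfolding decomposable_def by blast
qed

lemma right_zero_act_eq:
  assumes "indecomposable_act S A act" "right_zero S z" "a \<in> A" "b \<in> A"
  shows "act a z = act b z"
proof (rule ccontr)
  assume neq: "act a z \<noteq> act b z"
  interpret right_act S A act
    using assms(1) by (simp add: indecomposable_act_def)
  have z: "z \<in> carrier S" "\<And>s. s \<in> carrier S \<Longrightarrow> s \<otimes>\<^bsub>S\<^esub> z = z"
    using assms(2) by (auto simp: right_zero_def)
  have "act (act x s) z = act x z" if "x \<in> A" "s \<in> carrier S" for x s
    using that z act_mult[of x s z] by simp
  \<comment> \<open>The fibre of \<open>x\<close> \<mapsto> \<open>x z\<close> through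
    \<open>a\<close> is invariant under the action and misses \<open>b\<close>, so it splits
    off.\<close>
  then have "decomposable S A act"
    using assms(3,4) neq
    by (intro decomposableI[where P = "\<lambda>x. act x z = act a z" and a = a and b = b]) auto
  then show False
    using assms(1) by (simp add: indecomposable_act_def)
qed

lemma right_act_prod_act:
  assumes "monoid S" "\<And>i. i \<in> I \<Longrightarrow> right_act S (A i) (act i)"
  shows "right_act S (PiE I A) (prod_act I act)"
proof -
  interpret monoid S by fact
  show ?thesis
  proof
    show "PiE I A \<noteq> {}"
      using right_act.nonempty[OF assms(2)] by (simp add: PiE_eq_empty_iff)
  next
    fix f s assume "f \<in> PiE I A" "s \<in> carrier S"
    then show "prod_act I act f s \<in> PiE I A"
      using right_act.act_closed[OF assms(2)] by (auto simp: prod_act_def PiE_mem)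
  next
    fix f s t assume "f \<in> PiE I A" "s \<in> carrier S" "t \<in> carrier S"
    then show "prod_act I act f (s \<otimes>\<^bsub>S\<^esub> t) = prod_act I act (prod_act I act f s) t"
      using right_act.act_mult[OF assms(2)]
      by (auto simp: prod_act_def PiE_mem intro!: restrict_ext)
  next
    fix f assume f: "f \<in> PiE I A"
    then show "prod_act I act f \<one>\<^bsub>S\<^esub> = f"
      using right_act.act_one[OF assms(2)] PiE_mem[OF f]
      by (intro extensionalityI[of _ I]) (auto simp: prod_act_def PiE_def)
  qed
qed

lemma right_zero_imp_products_indecomposable:
  assumes "monoid S" "right_zero S z"
  shows "products_indecomposable S TYPE('i) TYPE('a)"
  unfolding products_indecomposable_def
proof (intro allI impI)
  fix I :: "'i set" and A :: "'i \<Rightarrow> 'a set" and act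
  assume indec: "\<forall>i\<in>I. indecomposable_act S (A i) (act i)"
  have z: "z \<in> carrier S"
    using assms(2) by (simp add: right_zero_def)
  have "\<not> decomposable S (PiE I A) (prod_act I act)"
  proof
    assume "decomposable S (PiE I A) (prod_act I act)"
    then obtain B C where BC: "subact S (PiE I A) (prod_act I act) B"
      "subact S (PiE I A) (prod_act I act) C" "B \<inter> C = {}"
      unfolding decomposable_def by blast
    then obtain f g where fg: "f \<in> B" "g \<in> C"
      by (auto simp: subact_def)
    then have "f \<in> PiE I A" "g \<in> PiE I A"
      using BC by (auto simp: subact_def)
    then have "act i (f i) z = act i (g i) z" if "i \<in> I" for i
      using that indec right_zero_act_eq[OF _ assms(2), of "A i" "act i"] by (simp add: PiE_mem)
    then have "prod_act I act f z = prod_act I act g z"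
      unfolding prod_act_def by (rule restrict_ext)
    moreover have "prod_act I act f z \<in> B" "prod_act I act g z \<in> C"
      using BC fg z by (auto simp: subact_def)
    ultimately show False
      using BC(3) by auto
  qed
  then show "indecomposable_act S (PiE I A) (prod_act I act)"
    using right_act_prod_act[OF assms(1), of I A act] indec by (simp add: indecomposable_act_def)
qed

section \<open>Obtaining indecomposable acts\<close>

text \<open>A link is a common point of the cyclic subacts of \<open>x i\<close> and
  \<open>x (Suc i)\<close>, so consecutive generators cannot lie in different parts of a
  decomposition. By induction the part that contains \<open>x 0\<close> contains every generator,
  hence everything.\<close>

lemma indecomposable_act_chainI:
  fixes x :: "nat \<Rightarrow> 'b"
  assumes "right_act S A act"
    and x: "\<And>i. x i \<in> A"
    and gen: "\<And>a. a \<in> A \<Longrightarrow> \<exists>i. \<exists>s\<in>carrier S. a = act (x i) s"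
    and link: "\<And>i. \<exists>s\<in>carrier S. \<exists>t\<in>carrier S. act (x i) s = act (x (Suc i)) t"
  shows "indecomposable_act S A act"
proof -
  interpret right_act S A act by fact
  have sub: "B = A"
    if B: "subact S A act B" and C: "subact S A act C" and BC: "A = B \<union> C" "B \<inter> C = {}"
      and x0: "x 0 \<in> B" for B C
  proof -
    have "x i \<in> B" for i
    proof (induction i)
      case (Suc i)
      obtain s t where "s \<in> carrier S" "t \<in> carrier S" "act (x i) s = act (x (Suc i)) t"
        using link by blast
      then have "act (x (Suc i)) t \<in> B" "x (Suc i) \<in> C \<Longrightarrow> act (x (Suc i)) t \<in> C"
        using Suc B C unfolding subact_def by metis+
      then show ?case
        using x[of "Suc i"] BC by auto
    qed (fact x0)
    then show ?thesis
      using gen B unfolding subact_def by blast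
  qed
  have "\<not> decomposable S A act"
  proof
    assume "decomposable S A act"
    then obtain B C where BC: "subact S A act B" "subact S A act C" "A = B \<union> C" "B \<inter> C = {}"
      unfolding decomposable_def by blast
    moreover have "x 0 \<in> B \<or> x 0 \<in> C"
      using x BC by auto
    ultimately have "B = A \<or> C = A"
      using sub[of B C] sub[of C B] by (metis inf_commute sup_commute)
    then show False
      using BC unfolding subact_def by blast
  qed
  then show ?thesis
    using assms(1) by (simp add: indecomposable_act_def)
qed

text \<open>Serves to move an act on pairs into the type \<open>act_carrier\<close> of sets of
  pairs: wrapping points as singletons is an isomorphism of acts, so decompositions pull
  back.\<close>

lemma indecomposable_act_singletons:
  assumes "indecomposable_act S A act"
  shows "indecomposable_act S ((\<lambda>x. {x}) ` A) (\<lambda>X s. {act (the_elem X) s})"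
    (is "indecomposable_act S ?A ?act")
proof -
  interpret right_act S A act
    using assms by (simp add: indecomposable_act_def)
  have "right_act S ?A ?act"
    by unfold_locales (use nonempty act_closed act_mult act_one in auto)
  moreover have "\<not> decomposable S ?A ?act"
  proof
    assume "decomposable S ?A ?act"
    then obtain B C where BC: "subact S ?A ?act B" "subact S ?A ?act C"
      "?A = B \<union> C" "B \<inter> C = {}"
      unfolding decomposable_def by blast
    have sub: "subact S A act {x \<in> A. {x} \<in> D}" if "subact S ?A ?act D" for D
      unfolding subact_def
    proof (intro conjI ballI)
      show "{x \<in> A. {x} \<in> D} \<noteq> {}"
        using that by (auto simp: subact_def)
    next
      fix x s assume x: "x \<in> {x \<in> A. {x} \<in> D}" and s: "s \<in> carrier S"
      then have "{act (the_elem {x}) s} \<in> D"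
        using that unfolding subact_def by blast
      then show "act x s \<in> {x \<in> A. {x} \<in> D}"
        using x s act_closed by simp
    qed auto
    have "A = {x \<in> A. {x} \<in> B} \<union> {x \<in> A. {x} \<in> C}"
      "{x \<in> A. {x} \<in> B} \<inter> {x \<in> A. {x} \<in> C} = {}"
      using BC(3,4) by auto
    then have "decomposable S A act"
      unfolding decomposable_def using sub BC(1,2) by blast
    then show False
      using assms by (simp add: indecomposable_act_def)
  qed
  ultimately show ?thesis
    by (simp add: indecomposable_act_def)
qed

section \<open>Powers that decompose\<close>

text \<open>The families made constant by some \<open>q\<close> split off. If \<open>q\<close> works
  for \<open>g r\<close>, then \<open>r q\<close> works for \<open>g\<close>; the opposite direction
  is where common right multiples enter.\<close>

lemma (in right_act) decomposable_power_if_reversible: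
  assumes rev: "\<And>u v. u \<in> carrier S \<Longrightarrow> v \<in> carrier S \<Longrightarrow>
      \<exists>p\<in>carrier S. \<exists>q\<in>carrier S. u \<otimes> p = v \<otimes> q"
    and f: "f \<in> I \<rightarrow>\<^sub>E A"
    and nonconst: "\<And>q c. q \<in> carrier S \<Longrightarrow> \<exists>i\<in>I. act (f i) q \<noteq> c"
  shows "decomposable S (I \<rightarrow>\<^sub>E A) (prod_act I (\<lambda>_. act))"
proof -
  let ?const = "\<lambda>g. \<exists>q\<in>carrier S. \<exists>c. \<forall>i\<in>I. act (g i) q = c"
  interpret P: right_act S "I \<rightarrow>\<^sub>E A" "prod_act I (\<lambda>_. act)"
    by (rule right_act_prod_act) unfold_locales
  have gA: "g i \<in> A" if "g \<in> I \<rightarrow>\<^sub>E A" "i \<in> I" for g i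
    using PiE_mem[OF that] .
  have const_iff: "?const (prod_act I (\<lambda>_. act) g r) \<longleftrightarrow> ?const g"
    if g: "g \<in> I \<rightarrow>\<^sub>E A" and r: "r \<in> carrier S" for g r
  proof
    assume "?const (prod_act I (\<lambda>_. act) g r)"
    then obtain q c where q: "q \<in> carrier S" "\<forall>i\<in>I. act (act (g i) r) q = c"
      by (auto simp: prod_act_def)
    then have "\<forall>i\<in>I. act (g i) (r \<otimes> q) = c"
      using g r act_mult by (simp add: gA)
    then show "?const g"
      using r q by blast
  next
    assume "?const g"
    then obtain q c where q: "q \<in> carrier S" "\<forall>i\<in>I. act (g i) q = c"
      by auto
    \<comment> \<open>With \<open>r p = q p'\<close>, the coordinate
      \<open>(g i r) p = (g i q) p' = c p'\<close> does not depend on \<open>i\<close>.\<close>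
    obtain p p' where p: "p \<in> carrier S" "p' \<in> carrier S" "r \<otimes> p = q \<otimes> p'"
      using rev[OF r q(1)] by blast
    have "act (act (g i) r) p = act c p'" if "i \<in> I" for i
      using that g r q p act_mult[of "g i" r p] act_mult[of "g i" q p'] by (simp add: gA)
    then show "?const (prod_act I (\<lambda>_. act) g r)"
      using p by (auto simp: prod_act_def)
  qed
  obtain a where a: "a \<in> A"
    using nonempty by blast
  show ?thesis
  proof (rule P.decomposableI[where P = ?const, OF const_iff])
    show "(\<lambda>i\<in>I. a) \<in> I \<rightarrow>\<^sub>E A"
      using a by auto
    show "?const (\<lambda>i\<in>I. a)"
      by (auto intro!: bexI[OF _ one_closed])
    show "\<not> ?const f"
      using nonconst by meson
  qed (use f in simp_all)
qed

text \<open>A bound \<open>N\<close> on the levels of \<open>g\<close> survives the action, and a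
  bound \<open>N\<close> after acting gives \<open>Suc N\<close> before, so boundedness is an
  invariant predicate.\<close>

lemma (in right_act) decomposable_power_if_unbounded_level:
  fixes level :: "'b \<Rightarrow> nat"
  assumes le: "\<And>a s. a \<in> A \<Longrightarrow> s \<in> carrier S \<Longrightarrow> level (act a s) \<le> level a"
    and ge: "\<And>a s. a \<in> A \<Longrightarrow> s \<in> carrier S \<Longrightarrow> level a \<le> Suc (level (act a s))"
    and f: "f \<in> I \<rightarrow>\<^sub>E A"
    and unbounded: "\<And>N. \<exists>i\<in>I. level (f i) > N"
  shows "decomposable S (I \<rightarrow>\<^sub>E A) (prod_act I (\<lambda>_. act))"
proof -
  let ?bdd = "\<lambda>g. \<exists>N. \<forall>i\<in>I. level (g i) \<le> N"
  interpret P: right_act S "I \<rightarrow>\<^sub>E A" "prod_act I (\<lambda>_. act)"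
    by (rule right_act_prod_act) unfold_locales
  have gA: "g i \<in> A" if "g \<in> I \<rightarrow>\<^sub>E A" "i \<in> I" for g i
    using PiE_mem[OF that] .
  have bdd_iff: "?bdd (prod_act I (\<lambda>_. act) g r) \<longleftrightarrow> ?bdd g"
    if g: "g \<in> I \<rightarrow>\<^sub>E A" and r: "r \<in> carrier S" for g r
  proof
    assume "?bdd (prod_act I (\<lambda>_. act) g r)"
    then obtain N where "\<forall>i\<in>I. level (act (g i) r) \<le> N"
      by (auto simp: prod_act_def)
    then have "\<forall>i\<in>I. level (g i) \<le> Suc N"
      using ge[OF gA[OF g] r] by (meson Suc_le_mono le_trans)
    then show "?bdd g"
      by blast
  next
    assume "?bdd g"
    then obtain N where "\<forall>i\<in>I. level (g i) \<le> N"
      by auto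
    then have "\<forall>i\<in>I. level (act (g i) r) \<le> N"
      using le[OF gA[OF g] r] by (meson le_trans)
    then show "?bdd (prod_act I (\<lambda>_. act) g r)"
      by (auto simp: prod_act_def)
  qed
  obtain a where a: "a \<in> A"
    using nonempty by blast
  show ?thesis
  proof (rule P.decomposableI[where P = ?bdd, OF bdd_iff])
    show "(\<lambda>i\<in>I. a) \<in> I \<rightarrow>\<^sub>E A"
      using a by auto
    show "?bdd (\<lambda>i\<in>I. a)"
      by auto
    show "\<not> ?bdd f"
      using unbounded by (meson not_le)
  qed (use f in simp_all)
qed

section \<open>The glued act\<close>

text \<open>The act glued from copies of \<open>S\<close> by identifying \<open>(i, s)\<close> with \<open>(Suc i, s)\<close> for
  \<open>s \<in> J i\<close>; as consecutive \<open>J i\<close> will be disjoint, the least copy containing a point gives a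
  canonical representative.\<close>

fun glue_rep :: "(nat \<Rightarrow> 's set) \<Rightarrow> nat \<Rightarrow> 's \<Rightarrow> nat \<times> 's" where
  "glue_rep J 0 s = (0, s)"
| "glue_rep J (Suc i) s = (if s \<in> J i then (i, s) else (Suc i, s))"

definition glue_carrier :: "('s, 'm) monoid_scheme \<Rightarrow> (nat \<Rightarrow> 's set) \<Rightarrow> (nat \<times> 's) set" where
  "glue_carrier S J = {(i, s). s \<in> carrier S \<and> glue_rep J i s = (i, s)}"

definition glue_act ::
  "('s, 'm) monoid_scheme \<Rightarrow> (nat \<Rightarrow> 's set) \<Rightarrow> nat \<times> 's \<Rightarrow> 's \<Rightarrow> nat \<times> 's" where
  "glue_act S J p t = glue_rep J (fst p) (snd p \<otimes>\<^bsub>S\<^esub> t)"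

text \<open>Normalisation descends by at most one copy; this yields both level inequalities for the
  glued act.\<close>

lemma fst_glue_rep_le: "fst (glue_rep J i s) \<le> i" "i \<le> Suc (fst (glue_rep J i s))"
  by (induction J i s rule: glue_rep.induct) simp_all

lemma indecomposable_glue_act:
  assumes "monoid S"
    and J_sub: "\<And>i. J i \<subseteq> carrier S"
    and J_ne: "\<And>i. J i \<noteq> {}"
    and J_ideal: "\<And>i s t. s \<in> J i \<Longrightarrow> t \<in> carrier S \<Longrightarrow> s \<otimes>\<^bsub>S\<^esub> t \<in> J i"
    and J_disj: "\<And>i. J i \<inter> J (Suc i) = {}"
  shows "indecomposable_act S (glue_carrier S J) (glue_act S J)"
    and "(i, \<one>\<^bsub>S\<^esub>) \<in> glue_carrier S J"
proof -
  interpret monoid S by fact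
  \<comment> \<open>A point that has descended through \<open>J (Suc i)\<close> is not in
    \<open>J i\<close>, so the single descent in \<open>glue_rep\<close> already reaches the normal
    form.\<close>
  have J_notin: "s \<notin> J i" if "s \<in> J (Suc i)" for s i
    using J_disj[of i] that by blast
  \<comment> \<open>If \<open>J i\<close> contained the identity, it would be all of
    \<open>S\<close> and leave no room for \<open>J (Suc i)\<close>. Hence
    \<open>(i, \<one>)\<close> is in normal form and can generate copy \<open>i\<close>.\<close>
  have one_notin: "\<one>\<^bsub>S\<^esub> \<notin> J i" for i
  proof
    assume "\<one>\<^bsub>S\<^esub> \<in> J i"
    then have "carrier S \<subseteq> J i"
      using J_ideal[of "\<one>\<^bsub>S\<^esub>" i] by auto
    then show False
      using J_sub[of "Suc i"] J_ne[of "Suc i"] J_disj[of i] by blast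
  qed
  show one_in: "(i, \<one>\<^bsub>S\<^esub>) \<in> glue_carrier S J" for i
    by (cases i) (auto simp: glue_carrier_def one_notin)
  have rep_in: "glue_rep J i s \<in> glue_carrier S J" if "s \<in> carrier S" for i s
  proof (cases i)
    case (Suc j)
    then show ?thesis
      using that by (cases j) (auto simp: glue_carrier_def J_notin)
  qed (use that in \<open>auto simp: glue_carrier_def\<close>)
  \<comment> \<open>Normalising before or after multiplying agrees: once \<open>s\<close> descends,
    the ideal property makes \<open>s t\<close> descend too.\<close>
  have rep_act: "glue_act S J (glue_rep J i s) t = glue_rep J i (s \<otimes>\<^bsub>S\<^esub> t)"
    if "s \<in> carrier S" "t \<in> carrier S" for i s t
  proof (cases i)
    case (Suc j)
    show ?thesis
    proof (cases "s \<in> J j")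
      case True
      then have "s \<otimes>\<^bsub>S\<^esub> t \<in> J j"
        using J_ideal[OF True that(2)] by simp
      then show ?thesis
        using Suc True by (cases j) (auto simp: glue_act_def J_notin)
    qed (simp add: glue_act_def Suc)
  qed (simp add: glue_act_def)
  have carrierD: "snd p \<in> carrier S" "glue_rep J (fst p) (snd p) = p"
    if "p \<in> glue_carrier S J" for p
    using that by (auto simp: glue_carrier_def)
  have act: "right_act S (glue_carrier S J) (glue_act S J)"
  proof
    show "glue_carrier S J \<noteq> {}"
      using one_in by blast
  next
    fix p s assume "p \<in> glue_carrier S J" "s \<in> carrier S"
    then show "glue_act S J p s \<in> glue_carrier S J"
      by (simp add: glue_act_def rep_in carrierD)
  next
    fix p s t assume "p \<in> glue_carrier S J" "s \<in> carrier S" "t \<in> carrier S"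
    then show "glue_act S J p (s \<otimes>\<^bsub>S\<^esub> t) = glue_act S J (glue_act S J p s) t"
      by (simp add: glue_act_def[of S J p] rep_act carrierD m_assoc)
  next
    fix p assume "p \<in> glue_carrier S J"
    then show "glue_act S J p \<one>\<^bsub>S\<^esub> = p"
      by (simp add: glue_act_def carrierD)
  qed
  show "indecomposable_act S (glue_carrier S J) (glue_act S J)"
  proof (rule indecomposable_act_chainI[where x = "\<lambda>i. (i, \<one>\<^bsub>S\<^esub>)", OF act one_in])
    fix p assume "p \<in> glue_carrier S J"
    then show "\<exists>i. \<exists>s\<in>carrier S. p = glue_act S J (i, \<one>\<^bsub>S\<^esub>) s"
      by (intro exI[of _ "fst p"] bexI[of _ "snd p"]) (simp_all add: glue_act_def carrierD)
  next
    fix i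
    obtain s where s: "s \<in> J i" "s \<in> carrier S"
      using J_ne[of i] J_sub[of i] by blast
    \<comment> \<open>Along \<open>J i\<close> the point \<open>(Suc i, s)\<close> is identified
      with \<open>(i, s)\<close>, which descends no further.\<close>
    then have "glue_act S J (i, \<one>\<^bsub>S\<^esub>) s = glue_act S J (Suc i, \<one>\<^bsub>S\<^esub>) s"
      by (cases i) (auto simp: glue_act_def J_notin)
    then show "\<exists>s\<in>carrier S. \<exists>t\<in>carrier S.
        glue_act S J (i, \<one>\<^bsub>S\<^esub>) s = glue_act S J (Suc i, \<one>\<^bsub>S\<^esub>) t"
      using s by blast
  qed
qed

section \<open>From indecomposable powers to a right zero\<close>

lemma products_indecomposable_imp_reversible:
  fixes S :: "('s, 'm) monoid_scheme"
  assumes "monoid S"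
    and prod: "products_indecomposable S TYPE('s scheme_index) TYPE('s act_carrier)"
    and uv: "u \<in> carrier S" "v \<in> carrier S"
  shows "\<exists>p\<in>carrier S. \<exists>q\<in>carrier S. u \<otimes>\<^bsub>S\<^esub> p = v \<otimes>\<^bsub>S\<^esub> q"
proof (rule ccontr)
  assume disj: "\<not> ?thesis"
  interpret monoid S by fact
  \<comment> \<open>Alternating the disjoint ideals \<open>u S\<close> and \<open>v S\<close> keeps
    consecutive gluing sets disjoint.\<close>
  define J where "J i = (\<lambda>s. (if even i then u else v) \<otimes>\<^bsub>S\<^esub> s) ` carrier S" for i :: nat
  have J: "J i \<subseteq> carrier S" "J i \<noteq> {}" "J i \<inter> J (Suc i) = {}" for i
    using uv disj one_closed by (auto simp: J_def) metis+
  have "s \<otimes>\<^bsub>S\<^esub> t \<in> J i" if "s \<in> J i" "t \<in> carrier S" for i s t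
    using that uv by (auto simp: J_def m_assoc)
  note glue = indecomposable_glue_act[where J = J, OF assms(1) J(1,2) this J(3)]
  let ?A = "(\<lambda>p. {p}) ` glue_carrier S J" and ?act = "\<lambda>X s. {glue_act S J (the_elem X) s}"
  have indec: "indecomposable_act S ?A ?act"
    using glue(1) by (rule indecomposable_act_singletons)
  then interpret right_act S ?A ?act
    by (simp add: indecomposable_act_def)
  have "decomposable S ((UNIV :: 's scheme_index set) \<rightarrow>\<^sub>E ?A) (prod_act UNIV (\<lambda>_. ?act))"
  \<comment> \<open>The index set consists of lists, and their lengths play the role of the natural
    numbers: coordinate \<open>l\<close> is the generator of copy \<open>length l\<close>.\<close>
  proof (rule decomposable_power_if_unbounded_level
      [where level = "\<lambda>X. fst (the_elem X)" and f = "\<lambda>l. {(length l, \<one>\<^bsub>S\<^esub>)}"])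
    show "\<exists>l\<in>UNIV. N < fst (the_elem {(length (l :: 's scheme_index), \<one>\<^bsub>S\<^esub>)})" for N
      \<comment> \<open>Only the length of the list counts; \<open>undefined\<close> is a filler
        entry.\<close>
      by (auto intro: exI[of _ "replicate (Suc N) undefined"])
  next
    fix X s assume "X \<in> ?A"
    then show "fst (the_elem (?act X s)) \<le> fst (the_elem X)"
      "fst (the_elem X) \<le> Suc (fst (the_elem (?act X s)))"
      by (simp_all add: glue_act_def fst_glue_rep_le)
  next
    show "(\<lambda>l. {(length l, \<one>\<^bsub>S\<^esub>)}) \<in> (UNIV :: 's scheme_index set) \<rightarrow>\<^sub>E ?A"
      using glue(2) by (simp add: PiE_UNIV_domain)
  qed
  then show False
    using prod indec by (auto simp: products_indecomposable_def indecomposable_act_def)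
qed

lemma products_indecomposable_imp_right_zero:
  fixes S :: "('s, 'm) monoid_scheme"
  assumes "monoid S"
    and prod: "products_indecomposable S TYPE('s scheme_index) TYPE('s act_carrier)"
  shows "\<exists>z. right_zero S z"
proof (rule ccontr)
  assume no_zero: "\<not> ?thesis"
  interpret monoid S by fact
  \<comment> \<open>The act is \<open>S\<close> itself, tagged with 0 so that its points are pairs
    whose singletons fit \<open>act_carrier\<close>.\<close>
  let ?act = "\<lambda>p s. (fst p, snd p \<otimes>\<^bsub>S\<^esub> s)"
  have act: "right_act S ({0 :: nat} \<times> carrier S) ?act"
    by unfold_locales (auto simp: m_assoc)
  have "indecomposable_act S ({0 :: nat} \<times> carrier S) ?act"
    \<comment> \<open>The identity generates \<open>S\<close>, so a constant chain suffices.\<close>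
    by (rule indecomposable_act_chainI[where x = "\<lambda>_. (0, \<one>\<^bsub>S\<^esub>)", OF act]) auto
  note indec = indecomposable_act_singletons[OF this]
  let ?A = "(\<lambda>p. {p}) ` ({0 :: nat} \<times> carrier S)"
    and ?act' = "\<lambda>X s. {?act (the_elem X) s}"
  interpret right_act S ?A ?act'
    using indec by (simp add: indecomposable_act_def)
  \<comment> \<open>One-entry lists encode the elements of \<open>S\<close> as indices; under this
    coding the family \<open>f\<close> chosen below is the identity map of \<open>S\<close>.\<close>
  let ?I = "(\<lambda>s. [(s, s)]) ` carrier S"
  have "decomposable S (?I \<rightarrow>\<^sub>E ?A) (prod_act ?I (\<lambda>_. ?act'))"
  proof (rule decomposable_power_if_reversible
      [where f = "\<lambda>l\<in>?I. {(0, fst (hd l))}"])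
    show "\<exists>p\<in>carrier S. \<exists>q\<in>carrier S. u \<otimes>\<^bsub>S\<^esub> p = v \<otimes>\<^bsub>S\<^esub> q"
      if "u \<in> carrier S" "v \<in> carrier S" for u v
      using products_indecomposable_imp_reversible[OF assms that] .
  next
    fix q and c :: "'s act_carrier" assume q: "q \<in> carrier S"
    show "\<exists>l\<in>?I. ?act' ((\<lambda>l\<in>?I. {(0 :: nat, fst (hd l))}) l) q \<noteq> c"
    proof (rule ccontr)
      assume "\<not> ?thesis"
      then have "{(0 :: nat, s \<otimes>\<^bsub>S\<^esub> q)} = c" if "s \<in> carrier S" for s
        using that by auto
      \<comment> \<open>Comparing index \<open>s\<close> with index \<open>\<one>\<close> gives
        \<open>s q = q\<close>, so \<open>q\<close> would be a right zero.\<close>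
      then have "s \<otimes>\<^bsub>S\<^esub> q = \<one>\<^bsub>S\<^esub> \<otimes>\<^bsub>S\<^esub> q" if "s \<in> carrier S" for s
        using that one_closed by (metis prod.inject singleton_inject)
      then show False
        using q no_zero by (auto simp: right_zero_def)
    qed
  qed auto
  then show False
    using prod indec by (auto simp: products_indecomposable_def indecomposable_act_def)
qed

theorem theorem3p9:
  fixes S :: "('s, 'm) monoid_scheme"
  assumes "monoid S"
  shows "(products_indecomposable S TYPE('s scheme_index) TYPE('s act_carrier)
            \<longleftrightarrow> (\<exists>z. right_zero S z))
       \<and> ((\<exists>z. right_zero S z) \<longrightarrow> products_indecomposable S TYPE('i) TYPE('a))"
proof (intro conjI iffI impI)
  assume "\<exists>z. right_zero S z"
  then obtain z where z: "right_zero S z" ..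
  show "products_indecomposable S TYPE('s scheme_index) TYPE('s act_carrier)"
    using assms z by (rule right_zero_imp_products_indecomposable)
  show "products_indecomposable S TYPE('i) TYPE('a)"
    using assms z by (rule right_zero_imp_products_indecomposable)
next
  assume "products_indecomposable S TYPE('s scheme_index) TYPE('s act_carrier)"
  with assms show "\<exists>z. right_zero S z"
    by (rule products_indecomposable_imp_right_zero)
qed

end
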